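(* Let $Q=(q(i,j))_{i,j\in\mathbb{Z}_+}$ be an ergodic generator, partitioned into levels $L_0,L_1,\dots$ with blocks $Q_{k,\ell}$, with stationary distribution vector $\pi=(\pi_0,\pi_1,\dots)$, and suppose that $Q$ is in lower block-Hessenberg form, i.e. $Q_{k,\ell}=O$ whenever $\ell\ge k+2$. Let $\alpha_0$ be a $1\times m_0$ probability vector. Suppose there exist $b\in(0,\infty)$, a column vector $v=(v(i))_{i\in\mathbb{Z}_+}$ with $v(i)\ge1$ for all $i$, and a finite set $C\subset\mathbb{Z}_+$ such that $$\sum_{j\in\mathbb{Z}_+}q(i,j)v(j)\le-|q(i,i)|-1+b\,1_C(i)\qquad\text{for all }i\in\mathbb{Z}_+ .$$ Then $$\pi_k=\lim_{s\to\infty}\frac{\alpha_0\,{}_{(s)}R_0^*\,{}_{(s)}R_{0,k}}{\alpha_0\sum_{\ell=0}^s{}_{(s)}R_0^*\,{}_{(s)}R_{0,\ell}\,e},\qquad k\in\mathbb{Z}_+,$$ or equivalently, $$\pi_k=\lim_{s\to\infty}\frac{\alpha_0\,{}_{(s)}R_0^*\,{}_{(s)}R_1\,{}_{(s)}R_2\cdots{}_{(s)}R_k}{\alpha_0\sum_{\ell=0}^s{}_{(s)}R_0^*\,{}_{(s)}R_1\,{}_{(s)}R_2\cdots{}_{(s)}R_\ell\,e},\qquad k\in\mathbb{Z}_+ .$$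
   Context: $\mathbb{Z}_+=\{0,1,2,\dots\}$. An ergodic generator is the infinitesimal generator ($Q$-matrix) $Q=(q(i,j))_{i,j\in\mathbb{Z}_+}$ of an ergodic (irreducible and positive recurrent, hence non-explosive) continuous-time Markov chain on $\mathbb{Z}_+$; thus $\sum_{j}q(i,j)=0$, $q(i,i)\in(-\infty,0)$ and $q(i,j)\ge 0$ for $j\ne i$. Its stationary distribution vector $\pi$ is the unique positive row vector with $\pi Q=0$ and $\pi e=1$, where $e$ is a column vector of ones of appropriate order. $1_C$ is the indicator function of $C$. Levels: let $m_0,m_1,\dots$ be positive integers, $n_{-1}=-1$, $n_s=\sum_{\ell=0}^sm_\ell-1$, and $L_s=\{n_{s-1}+1,\dots,n_s\}$ (level $s$, of cardinality $m_s$). Then $Q_{k,\ell}=(q(i,j))_{i\in L_k,j\in L_\ell}$ and $\pi_k=(\pi(i))_{i\in L_k}$. For lower block-Hessenberg $Q$ and each $s\in\mathbb{Z}_+$, define recursively for $k=s,s-1,\dots,0$ $${}_{(s)}R_k^*=\Big(-Q_{k,k}-\sum_{\ell=k+1}^s{}_{(s)}R_{k,\ell}\,Q_{\ell,k}\Big)^{-1},$$ (with the empty sum equal to zero, so ${}_{(s)}R_s^*=(-Q_{s,s})^{-1}$), where ${}_{(s)}R_{k,k}=I$ and, for $k+1\le\ell\le s$, $${}_{(s)}R_{k,\ell}=(Q_{k,k+1}\,{}_{(s)}R_{k+1}^* )(Q_{k+1,k+2}\,{}_{(s)}R_{k+2}^* )\cdots(Q_{\ell-1,\ell}\,{}_{(s)}R_\ell^*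 ).$$ (The inverses exist.) For $1\le k\le s$, ${}_{(s)}R_k=Q_{k-1,k}\,{}_{(s)}R_k^*$; an empty product of the ${}_{(s)}R_k$ is the identity. *)

theory Defs
  imports "HOL-Probability.Probability" "Jordan_Normal_Form.Gauss_Jordan_Elimination"
begin

section \<open>Ergodic generators\<close>

text \<open>
  The chain is described by its jump chain and its holding times: a trajectory is a sequence
  \<open>\<omega>\<close> whose entry \<open>\<omega> n\<close> is the \<open>n\<close>-th visited state together with the time spent there.
\<close>

definition stable_conservative :: "(nat \<Rightarrow> nat \<Rightarrow> real) \<Rightarrow> bool" where
  "stable_conservative q \<longleftrightarrow>
     (\<forall>i. q i i < 0) \<and> (\<forall>i j. i \<noteq> j \<longrightarrow> q i j \<ge> 0) \<and> (\<forall>i. (q i has_sum 0) UNIV)"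

definition irreducible_generator :: "(nat \<Rightarrow> nat \<Rightarrow> real) \<Rightarrow> bool" where
  "irreducible_generator q \<longleftrightarrow> (\<forall>i j. (i, j) \<in> {(i, j). i \<noteq> j \<and> q i j > 0}\<^sup>*)"

definition jump_prob :: "(nat \<Rightarrow> nat \<Rightarrow> real) \<Rightarrow> nat \<Rightarrow> nat \<Rightarrow> real" where
  "jump_prob q i j = (if i = j then 0 else q i j / (- q i i))"

text \<open>
  The law of the chain with generator \<open>q\<close> started in \<open>i\<close>: the jump chain is Markov with
  transition matrix \<^term>\<open>jump_prob q\<close>, and given the jump chain the holding times are
  independent, exponential with parameter \<open>- q x x\<close> in state \<open>x\<close>.  The cylinder probabilities
  determine the measure, and by the Ionescu-Tulcea theorem it exists.
\<close>
definition chain_law ::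
  "(nat \<Rightarrow> nat \<Rightarrow> real) \<Rightarrow> nat \<Rightarrow> (nat \<Rightarrow> nat \<times> real) measure \<Rightarrow> bool" where
  "chain_law q i M \<longleftrightarrow>
     prob_space M \<and>
     sets M = sets (PiM UNIV (\<lambda>_. count_space UNIV \<Otimes>\<^sub>M borel)) \<and>
     (\<forall>n x t. (\<forall>k\<le>n. t k \<ge> 0) \<longrightarrow>
        measure M {\<omega>. \<forall>k\<le>n. fst (\<omega> k) = x k \<and> snd (\<omega> k) > t k} =
          (if x 0 = i then 1 else 0) *
          (\<Prod>k<n. jump_prob q (x k) (x (Suc k))) *
          (\<Prod>k\<le>n. exp (q (x k) (x k) * t k)))"

definition jump_time :: "(nat \<Rightarrow> nat \<times> real) \<Rightarrow> nat \<Rightarrow> real" where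
  "jump_time \<omega> n = (\<Sum>k<n. snd (\<omega> k))"

text \<open>
  From the explosion time (the supremum of the jump times) on, the chain is in no state: this is
  the minimal chain.
\<close>
definition in_state :: "(nat \<Rightarrow> nat \<times> real) \<Rightarrow> real \<Rightarrow> nat \<Rightarrow> bool" where
  "in_state \<omega> t i \<longleftrightarrow>
     (\<exists>n. jump_time \<omega> n \<le> t \<and> t < jump_time \<omega> (Suc n) \<and> fst (\<omega> n) = i)"

definition return_time :: "nat \<Rightarrow> (nat \<Rightarrow> nat \<times> real) \<Rightarrow> ennreal" where
  "return_time i \<omega> = Inf {ennreal t | t. jump_time \<omega> 1 \<le> t \<and> in_state \<omega> t i}"

definition positive_recurrent :: "(nat \<Rightarrow> nat \<Rightarrow> real) \<Rightarrow> bool" where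
  "positive_recurrent q \<longleftrightarrow>
     (\<forall>i. \<exists>M. chain_law q i M \<and> (\<integral>\<^sup>+ \<omega>. return_time i \<omega> \<partial>M) < \<infinity>)"

definition ergodic_generator :: "(nat \<Rightarrow> nat \<Rightarrow> real) \<Rightarrow> bool" where
  "ergodic_generator q \<longleftrightarrow>
     stable_conservative q \<and> irreducible_generator q \<and> positive_recurrent q"

definition stationary_distribution :: "(nat \<Rightarrow> nat \<Rightarrow> real) \<Rightarrow> (nat \<Rightarrow> real) \<Rightarrow> bool" where
  "stationary_distribution q \<pi> \<longleftrightarrow>
     (\<forall>i. \<pi> i > 0) \<and> (\<forall>j. ((\<lambda>i. \<pi> i * q i j) has_sum 0) UNIV) \<and> (\<pi> has_sum 1) UNIV"

section \<open>Levels and blocks\<close>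

text \<open>
  \<open>m k\<close> is the cardinality of level \<open>k\<close>.  \<open>level_start m k\<close> is \<open>n\<^bsub>k-1\<^esub> + 1\<close>, so that level \<open>k\<close> is
  \<open>{level_start m k ..< level_start m (Suc k)}\<close>.  Inside a block the indices start at 0.
\<close>
definition level_start :: "(nat \<Rightarrow> nat) \<Rightarrow> nat \<Rightarrow> nat" where
  "level_start m k = (\<Sum>l<k. m l)"

definition Qblock :: "(nat \<Rightarrow> nat) \<Rightarrow> (nat \<Rightarrow> nat \<Rightarrow> real) \<Rightarrow> nat \<Rightarrow> nat \<Rightarrow> real mat" where
  "Qblock m q k l =
     Matrix.mat (m k) (m l) (\<lambda>(i, j). q (level_start m k + i) (level_start m l + j))"

definition row_block :: "(nat \<Rightarrow> nat) \<Rightarrow> (nat \<Rightarrow> real) \<Rightarrow> nat \<Rightarrow> real mat" where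
  "row_block m x k = Matrix.mat 1 (m k) (\<lambda>(_, i). x (level_start m k + i))"

definition lower_block_Hessenberg :: "(nat \<Rightarrow> nat) \<Rightarrow> (nat \<Rightarrow> nat \<Rightarrow> real) \<Rightarrow> bool" where
  "lower_block_Hessenberg m q \<longleftrightarrow> (\<forall>k l. l \<ge> k + 2 \<longrightarrow> Qblock m q k l = 0\<^sub>m (m k) (m l))"

section \<open>Matrix operations\<close>

definition ones_col :: "nat \<Rightarrow> real mat" where
  "ones_col n = Matrix.mat n 1 (\<lambda>_. 1)"

text \<open>Unspecified for a singular matrix.\<close>
definition mat_inv :: "real mat \<Rightarrow> real mat" where
  "mat_inv A = the (mat_inverse A)"

definition mat_sum :: "nat \<Rightarrow> nat \<Rightarrow> ('a \<Rightarrow> real mat) \<Rightarrow> 'a set \<Rightarrow> real mat" where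
  "mat_sum nr nc F A = Matrix.mat nr nc (\<lambda>ij. \<Sum>a\<in>A. F a $$ ij)"

lemma mat_sum_cong [fundef_cong]:
  "A = B \<Longrightarrow> (\<And>a. a \<in> B \<Longrightarrow> F a = G a) \<Longrightarrow> mat_sum nr nc F A = mat_sum nr nc G B"
  unfolding mat_sum_def by (auto intro!: cong_mat sum.cong)

text \<open>Product from left to right of the listed matrices, the first of which has \<open>n\<close> rows.\<close>
definition mat_prod :: "nat \<Rightarrow> real mat list \<Rightarrow> real mat" where
  "mat_prod n Xs = foldl (*) (1\<^sub>m n) Xs"

section \<open>The R-matrices of the truncations\<close>

text \<open>
  The inner product over \<open>[k+1..<l+1]\<close> is the matrix \<open>\<^sub>(\<^sub>s\<^sub>)R\<^bsub>k,l\<^esub>\<close>, see \<open>Rblock\<close> below.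
  The recursion runs downwards from \<open>k = s\<close>; only \<open>k \<le> s\<close> is meaningful.
\<close>
function Rstar ::
  "(nat \<Rightarrow> nat) \<Rightarrow> (nat \<Rightarrow> nat \<Rightarrow> real) \<Rightarrow> nat \<Rightarrow> nat \<Rightarrow> real mat" where
  "Rstar m q s k =
     mat_inv (- Qblock m q k k -
       mat_sum (m k) (m k)
         (\<lambda>l. mat_prod (m k) (map (\<lambda>j. Qblock m q (j - 1) j * Rstar m q s j) [k+1..<l+1])
              * Qblock m q l k)
         {k+1..s})"
  by auto
termination
  by (relation "Wellfounded.measure (\<lambda>(m, q, s, k). s - k)") auto

declare Rstar.simps [simp del]

definition Rblock ::
  "(nat \<Rightarrow> nat) \<Rightarrow> (nat \<Rightarrow> nat \<Rightarrow> real) \<Rightarrow> nat \<Rightarrow> nat \<Rightarrow> nat \<Rightarrow> real mat" where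
  "Rblock m q s k l =
     mat_prod (m k) (map (\<lambda>j. Qblock m q (j - 1) j * Rstar m q s j) [k+1..<l+1])"

definition Rstep ::
  "(nat \<Rightarrow> nat) \<Rightarrow> (nat \<Rightarrow> nat \<Rightarrow> real) \<Rightarrow> nat \<Rightarrow> nat \<Rightarrow> real mat" where
  "Rstep m q s k = Qblock m q (k - 1) k * Rstar m q s k"

lemma Rstar_rec:
  "Rstar m q s k =
     mat_inv (- Qblock m q k k -
       mat_sum (m k) (m k) (\<lambda>l. Rblock m q s k l * Qblock m q l k) {k+1..s})"
  unfolding Rblock_def by (rule Rstar.simps)

end

theory Submission
  imports Defs "Jordan_Normal_Form.Determinant"
begin

text \<open>
  The row vector \<open>y\<^bsub>s\<^esub>\<close> with blocks \<open>\<alpha>\<^sub>0 R\<^sub>0\<^sup>* R\<^sub>0\<^sub>,\<^sub>l\<close> solves \<open>y\<^bsub>s\<^esub> Q = - \<alpha>\<^sub>0\<close> on the truncation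
  to the levels \<open>0, \<dots>, s\<close>: it is the expected occupation time before the chain started
  in \<open>\<alpha>\<^sub>0\<close> leaves these levels.  Let \<open>S\<^bsub>s\<^esub>\<close> be its mass.  The drift condition bounds the jump rate
  of \<open>y\<^bsub>s\<^esub>\<close> by a multiple of \<open>S\<^bsub>s\<^esub>\<close>, while the exit flow forces the last level to contribute at least
  1 to it; as \<open>y\<^bsub>s\<^esub>\<close> increases with \<open>s\<close>, the mass \<open>S\<^bsub>s\<^esub>\<close> tends to infinity.
  Adding to \<open>v\<close> a multiple of a superharmonic function turns the finite set \<open>C\<close> into any single state
  \<open>j\<close>, and testing the positive part of \<open>y\<^bsub>s\<^esub> - (y\<^bsub>s\<^esub>(j) / \<pi>(j)) \<pi>\<close> with the result gives
  \<open>S\<^bsub>s\<^esub> \<le> y\<^bsub>s\<^esub>(j) / \<pi>(j) + K\<^bsub>j\<^esub>\<close>.  Hence the lower limit of \<open>y\<^bsub>s\<^esub>(j) / S\<^bsub>s\<^esub>\<close> is at least \<open>\<pi>(j)\<close> for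
  all \<open>j\<close>, and since both sides have total mass 1 this is convergence.
\<close>

section \<open>Occupation measures of truncations\<close>

text \<open>The negative part \<open>p\<close> of \<open>z\<close> satisfies
  \<open>p T \<ge> 0\<close>; pairing it with \<open>w\<close> gives a value that is both
  nonnegative and, if \<open>p\<close> is nonzero, negative.\<close>

lemma Z_matrix_row_nonneg:
  fixes T :: "'a \<Rightarrow> 'a \<Rightarrow> real"
  assumes "finite A"
    and off: "\<And>i j. i \<in> A \<Longrightarrow> j \<in> A \<Longrightarrow> i \<noteq> j \<Longrightarrow> T i j \<ge> 0"
    and w: "\<And>i. i \<in> A \<Longrightarrow> w i > 0"
    and Tw: "\<And>i. i \<in> A \<Longrightarrow> (\<Sum>j\<in>A. T i j * w j) < 0"
    and zT: "\<And>j. j \<in> A \<Longrightarrow> (\<Sum>i\<in>A. z i * T i j) \<le> 0"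
    and "i \<in> A"
  shows "z i \<ge> 0"
proof (rule ccontr)
  assume neg: "\<not> z i \<ge> 0"
  define p where "p i = max 0 (- z i)" for i
  have p0: "p i \<ge> 0" for i by (simp add: p_def)
  \<comment> \<open>Where \<open>z j < 0\<close>, passing from \<open>- z\<close> to
    \<open>p\<close> keeps the diagonal term and can only raise the others; elsewhere
    \<open>p j = 0\<close> and no diagonal term is left.\<close>
  have pT: "(\<Sum>i\<in>A. p i * T i j) \<ge> 0" if j: "j \<in> A" for j
  proof (cases "z j < 0")
    case True
    have "0 \<le> (\<Sum>i\<in>A. - z i * T i j)" using zT[OF j] by (simp add: sum_negf)
    also have "\<dots> \<le> (\<Sum>i\<in>A. p i * T i j)"
    proof (rule sum_mono)
      fix i assume i: "i \<in> A"
      show "- z i * T i j \<le> p i * T i j"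
      proof (cases "i = j")
        case True
        then show ?thesis using \<open>z j < 0\<close> by (simp add: p_def)
      next
        case False
        then show ?thesis using off[OF i j] by (intro mult_right_mono) (auto simp: p_def)
      qed
    qed
    finally show ?thesis .
  next
    case False
    show ?thesis
    proof (rule sum_nonneg)
      fix i assume "i \<in> A"
      then show "0 \<le> p i * T i j"
        using False off[of i j] p0[of i] j by (cases "i = j") (auto simp: p_def)
    qed
  qed
  have "0 \<le> (\<Sum>j\<in>A. (\<Sum>i\<in>A. p i * T i j) * w j)"
    by (rule sum_nonneg, rule mult_nonneg_nonneg) (use pT w in \<open>auto simp: less_imp_le\<close>)
  also have "\<dots> = (\<Sum>i\<in>A. p i * (\<Sum>j\<in>A. T i j * w j))"
    unfolding sum_distrib_left sum_distrib_right by (subst sum.swap) (simp add: mult_ac)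
  also have "\<dots> < (\<Sum>i\<in>A. 0)"
  proof (rule sum_strict_mono_ex1)
    show "\<forall>i\<in>A. p i * (\<Sum>j\<in>A. T i j * w j) \<le> 0"
      using Tw p0 by (auto intro!: mult_nonneg_nonpos simp: less_imp_le)
    show "\<exists>i\<in>A. p i * (\<Sum>j\<in>A. T i j * w j) < 0"
      using \<open>i \<in> A\<close> neg Tw by (intro bexI[of _ i] mult_pos_neg) (auto simp: p_def)
  qed fact
  finally show False by simp
qed

section \<open>Generators with upward jumps of at most one level, and their test functions\<close>

locale banded_generator =
  fixes q :: "nat \<Rightarrow> nat \<Rightarrow> real" and N :: "nat \<Rightarrow> nat"
  assumes stable: "stable_conservative q"
    and irreducible: "irreducible_generator q"
    and N_strict_mono: "strict_mono N"
    and banded: "\<And>s i j. i < N s \<Longrightarrow> N (Suc s) \<le> j \<Longrightarrow> q i j = 0"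
begin

lemma diag_neg: "q i i < 0" and off_diag: "i \<noteq> j \<Longrightarrow> q i j \<ge> 0"
  and row_has_sum: "(q i has_sum 0) UNIV"
  using stable by (auto simp: stable_conservative_def)

lemma N_mono: "s \<le> t \<Longrightarrow> N s \<le> N t"
  using N_strict_mono by (simp add: strict_mono_less_eq)

lemma less_N: "i < N (Suc i)"
  using strict_mono_imp_increasing[OF N_strict_mono, of "Suc i"] by simp

definition act :: "(nat \<Rightarrow> real) \<Rightarrow> nat \<Rightarrow> real" where
  "act f i = (\<Sum>\<^sub>\<infinity>j. q i j * f j)"

text \<open>Bandedness gives row \<open>i\<close> finite support, so the infinite sum is finite for
  every large enough cutoff \<open>n\<close> and no convergence question arises.\<close>

lemma act_eq: "i < N s \<Longrightarrow> N (Suc s) \<le> n \<Longrightarrow> act f i = (\<Sum>j<n. q i j * f j)"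
  unfolding act_def
  by (subst infsum_cong_neutral[where T = "{..<n}" and g = "\<lambda>j. q i j * f j"])
     (auto simp: banded)

lemma act_add_scale: "act (\<lambda>j. f j + c * g j) i = act f i + c * act g i"
  by (simp add: act_eq[OF less_N order.refl] sum.distrib sum_distrib_left algebra_simps)

lemma act_const: "act (\<lambda>_. c) i = 0"
proof -
  have "act (\<lambda>_. 1) i = 0"
    using row_has_sum[of i] by (simp add: act_def infsumI)
  then have "(\<Sum>j<N (Suc (Suc i)). q i j) = 0"
    by (simp add: act_eq[OF less_N order.refl])
  then show ?thesis
    by (simp add: act_eq[OF less_N order.refl] flip: sum_distrib_right)
qed

text \<open>As \<open>i\<close> lies in \<open>A\<close>, only off-diagonal terms are dropped, and
  these are nonnegative.\<close>

lemma truncated_act_le: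
  assumes "finite A" "i \<in> A" "\<And>j. j \<notin> A \<Longrightarrow> f j \<ge> 0"
  shows "(\<Sum>j\<in>A. q i j * f j) \<le> act f i"
proof -
  obtain n where n: "A \<subseteq> {..<n}" using assms(1) finite_nat_iff_bounded by blast
  define k where "k = max n (N (Suc (Suc i)))"
  have "(\<Sum>j\<in>A. q i j * f j) \<le> (\<Sum>j<k. q i j * f j)"
    using assms n by (intro sum_mono2) (auto simp: k_def intro!: mult_nonneg_nonneg off_diag)
  also have "\<dots> = act f i" by (rule act_eq[OF less_N, symmetric]) (simp add: k_def)
  finally show ?thesis .
qed

text \<open>
  Such a \<open>g\<close> replaces the probability of ever hitting \<open>j\<close>; unlike the latter it can be built along
  finitely many paths.
\<close>
definition hitting_test :: "nat \<Rightarrow> (nat \<Rightarrow> real) \<Rightarrow> bool" where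
  "hitting_test j g \<longleftrightarrow> g j = 1 \<and>
     (\<forall>l. 0 \<le> g l \<and> (l \<noteq> j \<longrightarrow> g l < 1 \<and> (g l = 0 \<or> act g l > 0)))"

lemma act_mono_off_diag:
  assumes "\<And>l. f l \<le> g l" "f i = g i"
  shows "act f i \<le> act g i"
  unfolding act_eq[OF less_N order.refl]
  by (rule sum_mono) (metis assms mult_left_mono off_diag order.refl)

text \<open>Induction backwards along a path from \<open>i\<close> to \<open>j\<close>: a state of
  value 0 that jumps to a state of positive value has \<open>act g' i > 0\<close>, and this survives
  a slight raise of its own value.\<close>

lemma hitting_test_extend:
  assumes "hitting_test j g"
  shows "\<exists>g'. hitting_test j g' \<and> g \<le> g' \<and> g' i > 0"
proof -
  have "(i, j) \<in> {(i, j). i \<noteq> j \<and> q i j > 0}\<^sup>*"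
    using irreducible by (auto simp: irreducible_generator_def)
  then show ?thesis
  proof (induction rule: converse_rtrancl_induct)
    case base
    then show ?case using assms by (intro exI[of _ g]) (auto simp: hitting_test_def)
  next
    case (step i k)
    then obtain g' where g': "hitting_test j g'" "g \<le> g'" "g' k > 0" by blast
    from step have ik: "i \<noteq> k" "q i k > 0" by auto
    show ?case
    proof (cases "g' i > 0")
      case True
      then show ?thesis using g' by blast
    next
      case False
      then have i0: "g' i = 0" and ij: "i \<noteq> j"
        using g'(1) by (auto simp: hitting_test_def order.order_iff_strict)
      have "0 < q i k * g' k" using ik g' by simp
      also have "\<dots> = (\<Sum>l\<in>{i, k}. q i l * g' l)" using i0 ik by simp
      also have "\<dots> \<le> act g' i"
        using g'(1) by (intro truncated_act_le) (auto simp: hitting_test_def)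
      finally have pos: "act g' i > 0" .
      \<comment> \<open>The raise costs \<open>e * - q i i\<close> at \<open>i\<close>, at most half
        of \<open>act g' i\<close>; the bound 1/2 keeps the new value below 1.\<close>
      define e where "e = min (1/2) (act g' i / (2 * - q i i))"
      have e: "0 < e" "e < 1" using pos diag_neg[of i] by (auto simp: e_def divide_simps)
      define h where "h = g'(i := e)"
      have le: "g' l \<le> h l" for l using e i0 by (auto simp: h_def)
      have "e * - q i i \<le> act g' i / 2"
        using diag_neg[of i] pos by (auto simp: e_def min_def field_simps split: if_splits)
      moreover have "act h i = act g' i + q i i * e"
      proof -
        have "act h i = act (\<lambda>l. g' l + e * of_bool (l = i)) i"
          using i0 by (intro arg_cong[where f = "\<lambda>f. act f i"]) (auto simp: h_def)
        also have "act (\<lambda>l. of_bool (l = i)) i = q i i"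
          using less_N[of i] N_mono[of "Suc i" "Suc (Suc i)"]
          by (simp add: act_eq[OF less_N order.refl] of_bool_def if_distrib cong: if_cong)
        then have "act (\<lambda>l. g' l + e * of_bool (l = i)) i = act g' i + q i i * e"
          by (simp add: act_add_scale)
        finally show ?thesis .
      qed
      ultimately have hi: "act h i > 0" using pos by (simp add: algebra_simps)
      \<comment> \<open>At states other than \<open>i\<close> the raise enters with a nonnegative
        rate and cannot decrease \<open>act\<close>.\<close>
      have "act h l > 0" if "l \<noteq> j" "h l \<noteq> 0" for l
      proof (cases "l = i")
        case True
        then show ?thesis using hi by simp
      next
        case False
        then have "act g' l > 0" using that g'(1) by (auto simp: hitting_test_def h_def)
        moreover have "act g' l \<le> act h l"
          using le False by (intro act_mono_off_diag) (auto simp: h_def)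
        ultimately show ?thesis by simp
      qed
      moreover have "h j = 1" "\<And>l. 0 \<le> h l" "\<And>l. l \<noteq> j \<Longrightarrow> h l < 1"
        using g'(1) e ij by (auto simp: h_def hitting_test_def)
      ultimately have "hitting_test j h" by (auto simp: hitting_test_def)
      moreover have "g \<le> h" using g'(2) le by (meson le_fun_def order_trans)
      moreover have "h i > 0" using e by (simp add: h_def)
      ultimately show ?thesis by blast
    qed
  qed
qed

lemma hitting_test_exists:
  assumes "finite A"
  shows "\<exists>g. hitting_test j g \<and> (\<forall>i\<in>A. g i > 0)"
  using assms
proof (induction A)
  case empty
  show ?case by (intro exI[of _ "\<lambda>i. of_bool (i = j)"]) (auto simp: hitting_test_def)
next
  case (insert i A)
  then obtain g where g: "hitting_test j g" "\<forall>i\<in>A. g i > 0" by blast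
  from hitting_test_extend[OF g(1), of i] obtain g'
    where "hitting_test j g'" "g \<le> g'" "g' i > 0" by blast
  with g(2) show ?case by (intro exI[of _ g']) (auto simp: le_fun_def intro: less_le_trans)
qed

text \<open>Take \<open>u = 1 - g\<close> for a hitting test \<open>g\<close> that is positive on
  \<open>A\<close>: constants have \<open>act\<close> zero, so the sign of \<open>act g\<close>
  flips.\<close>

lemma superharmonic_exists:
  assumes "finite A"
  obtains u where "\<And>i. u i \<ge> 0" "\<And>i. i \<noteq> j \<Longrightarrow> u i > 0"
    "\<And>i. i \<noteq> j \<Longrightarrow> act u i \<le> 0" "\<And>i. i \<in> A - {j} \<Longrightarrow> act u i < 0"
proof -
  obtain g where g: "hitting_test j g" "\<forall>i\<in>A. g i > 0"
    using hitting_test_exists[OF assms] by blast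
  define u where "u i = 1 - g i" for i
  have u: "act u i = - act g i" for i
    using act_add_scale[of "\<lambda>_. 1" "-1" g i] by (simp add: u_def[abs_def] act_const)
  have 1: "act g i \<ge> 0" if "i \<noteq> j" for i
  proof (cases "g i = 0")
    case True
    then have "0 = (\<Sum>l\<in>{i}. q i l * g l)" by simp
    also have "\<dots> \<le> act g i" using g(1) by (intro truncated_act_le) (auto simp: hitting_test_def)
    finally show ?thesis .
  next
    case False
    then show ?thesis using g(1) that by (auto simp: hitting_test_def less_imp_le)
  qed
  show ?thesis
  proof (rule that[of u])
    show "u i \<ge> 0" for i
      using g(1) by (cases "i = j") (auto simp: hitting_test_def u_def less_imp_le)
    show "u i > 0" if "i \<noteq> j" for i using g(1) that by (auto simp: hitting_test_def u_def)
    show "act u i \<le> 0" if "i \<noteq> j" for i using 1[OF that] by (simp add: u)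
    show "act u i < 0" if "i \<in> A - {j}" for i
      using g that by (force simp: hitting_test_def u)
  qed
qed

text \<open>The exceptional state is chosen as \<open>n\<close>, just outside the truncation, so
  that \<open>u\<close> is strictly superharmonic at all states below \<open>n\<close>; cutting the
  sums at \<open>n\<close> only decreases them.\<close>

lemma truncation_test_exists:
  obtains w where "\<And>i. i < n \<Longrightarrow> w i > 0" "\<And>i. i < n \<Longrightarrow> (\<Sum>j<n. q i j * w j) < 0"
proof -
  obtain u where u: "\<And>i. u i \<ge> 0" "\<And>i. i \<noteq> n \<Longrightarrow> u i > 0"
    "\<And>i. i \<noteq> n \<Longrightarrow> act u i \<le> 0" "\<And>i. i \<in> {..<n} - {n} \<Longrightarrow> act u i < 0"
    by (rule superharmonic_exists[of "{..<n}" n]) auto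
  show ?thesis
  proof (rule that[of u])
    fix i assume i: "i < n"
    then show "u i > 0" using u(2) by simp
    have "(\<Sum>j<n. q i j * u j) \<le> act u i" using i u(1) by (intro truncated_act_le) auto
    also have "\<dots> < 0" using u(4) i by simp
    finally show "(\<Sum>j<n. q i j * u j) < 0" .
  qed
qed

end

section \<open>Occupation rows of growing truncations and the growth of their mass\<close>

locale truncated_occupation = banded_generator +
  fixes a :: "nat \<Rightarrow> real" and y :: "nat \<Rightarrow> nat \<Rightarrow> real" and b :: real and v :: "nat \<Rightarrow> real"
    and C :: "nat set" and \<pi> :: "nat \<Rightarrow> real"
  assumes a_nonneg: "\<And>i. a i \<ge> 0"
    and a_supp: "\<And>i. i \<ge> N 0 \<Longrightarrow> a i = 0"
    and a_sum: "(\<Sum>i<N 0. a i) = 1"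
    and y_nonneg: "\<And>s i. i < N s \<Longrightarrow> y s i \<ge> 0"
    and y_balance: "\<And>s j. j < N s \<Longrightarrow> (\<Sum>i<N s. y s i * q i j) = - a j"
    and b_pos: "b > 0"
    and v_ge_1: "\<And>i. v i \<ge> 1"
    and C_finite: "finite C"
    and drift: "\<And>i. act v i \<le> - \<bar>q i i\<bar> - 1 + b * indicator C i"
    and stationary: "stationary_distribution q \<pi>"
begin

definition mass :: "nat \<Rightarrow> real" where "mass s = (\<Sum>i<N s. y s i)"

lemma a_sum_N: "(\<Sum>i<N s. a i * f i) = (\<Sum>i<N 0. a i * f i)"
  by (rule sum.mono_neutral_right) (auto simp: a_supp N_mono intro: less_le_trans[OF _ N_mono])

text \<open>Restricted to the first \<open>N s\<close> states, \<open>y (Suc s)\<close> lacks the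
  nonnegative inflow from the additional states, so the difference of the two rows is covered by
  \<open>Z_matrix_row_nonneg\<close>.\<close>

lemma y_mono:
  assumes "i < N s"
  shows "y s i \<le> y (Suc s) i"
proof -
  obtain w where w: "\<And>i. i < N s \<Longrightarrow> w i > 0" "\<And>i. i < N s \<Longrightarrow> (\<Sum>j<N s. q i j * w j) < 0"
    by (rule truncation_test_exists[of "N s"]) blast
  have "y (Suc s) i - y s i \<ge> 0"
  proof (rule Z_matrix_row_nonneg[where A = "{..<N s}" and T = q and w = w])
    fix j assume j: "j \<in> {..<N s}"
    have le: "N s \<le> N (Suc s)" by (rule N_mono) simp
    have "(\<Sum>i<N s. y (Suc s) i * q i j) \<le> (\<Sum>i<N (Suc s). y (Suc s) i * q i j)"
      using j le by (intro sum_mono2) (auto intro!: mult_nonneg_nonneg y_nonneg off_diag)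
    also have "\<dots> = - a j" using j le by (intro y_balance) auto
    also have "\<dots> = (\<Sum>i<N s. y s i * q i j)" using j by (simp add: y_balance)
    finally show "(\<Sum>i<N s. (y (Suc s) i - y s i) * q i j) \<le> 0"
      by (simp add: sum_subtractf left_diff_distrib)
  qed (use w off_diag assms in auto)
  then show ?thesis by simp
qed

lemma y_mono': "s \<le> t \<Longrightarrow> i < N s \<Longrightarrow> y s i \<le> y t i"
proof (induction rule: dec_induct)
  case (step t)
  then show ?case using y_mono[of i t] N_mono[of s t] by auto
qed simp

lemma mass_mono: "incseq mass"
proof (rule incseq_SucI)
  fix s
  have "mass s \<le> (\<Sum>i<N s. y (Suc s) i)"
    unfolding mass_def by (intro sum_mono y_mono) auto
  also have "\<dots> \<le> mass (Suc s)"
    unfolding mass_def using N_mono[of s "Suc s"] by (intro sum_mono2 y_nonneg) auto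
  finally show "mass s \<le> mass (Suc s)" .
qed

text \<open>The balance equations are paired with \<open>f\<close> and the sums exchanged; the
  inequality comes from replacing truncated rows by full ones.\<close>

lemma test_balance:
  assumes "\<And>i. f i \<ge> 0"
  shows "- (\<Sum>i<N 0. a i * f i) \<le> (\<Sum>i<N s. y s i * act f i)"
proof -
  have "- (\<Sum>i<N 0. a i * f i) = (\<Sum>j<N s. (\<Sum>i<N s. y s i * q i j) * f j)"
    using a_sum_N[of f s] by (simp add: y_balance sum_negf)
  also have "\<dots> = (\<Sum>i<N s. y s i * (\<Sum>j<N s. q i j * f j))"
    unfolding sum_distrib_left sum_distrib_right by (subst sum.swap) (simp add: mult_ac)
  also have "\<dots> \<le> (\<Sum>i<N s. y s i * act f i)"
    using assms y_nonneg by (intro sum_mono mult_left_mono truncated_act_le) auto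
  finally show ?thesis .
qed

text \<open>This is \<open>test_balance\<close> for \<open>v\<close>: the term
  \<open>- \<bar>q i i\<bar>\<close> of the drift condition yields the left side, and the indicator
  is bounded by 1.\<close>

lemma jump_rate_bound:
  "(\<Sum>i<N s. y s i * \<bar>q i i\<bar>) \<le> (\<Sum>i<N 0. a i * v i) + b * mass s"
proof -
  have "- (\<Sum>i<N 0. a i * v i) \<le> (\<Sum>i<N s. y s i * act v i)"
    using v_ge_1 by (intro test_balance) (meson order_trans zero_le_one)
  also have "\<dots> \<le> (\<Sum>i<N s. b * y s i - y s i * \<bar>q i i\<bar>)"
  proof (rule sum_mono)
    fix i assume "i \<in> {..<N s}"
    then have y: "y s i \<ge> 0" by (simp add: y_nonneg)
    have "act v i \<le> b - \<bar>q i i\<bar>"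
      using drift[of i] b_pos by (cases "i \<in> C") auto
    from mult_left_mono[OF this y] show "y s i * act v i \<le> b * y s i - y s i * \<bar>q i i\<bar>"
      by (simp add: algebra_simps)
  qed
  finally show ?thesis by (simp add: sum_subtractf mass_def flip: sum_distrib_left)
qed

text \<open>By bandedness only states of the last level can jump out of the truncation.\<close>
lemma exit_flow:
  "1 \<le> (\<Sum>i\<in>{N s..<N (Suc s)}. y (Suc s) i * \<bar>q i i\<bar>)"
proof -
  let ?A = "{..<N (Suc s)}"
  \<comment> \<open>The truncated row sum is minus the rate of leaving the truncation: zero for
    \<open>i < N s\<close> by bandedness, and at worst \<open>q i i\<close> in the last
    level.\<close>
  have ge: "- (of_bool (N s \<le> i) * \<bar>q i i\<bar>) \<le> (\<Sum>j\<in>?A. q i j)" if "i \<in> ?A" for i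
  proof (cases "N s \<le> i")
    case True
    have "q i i = (\<Sum>j\<in>{i}. q i j)" by simp
    also have "\<dots> \<le> (\<Sum>j\<in>?A. q i j)" using that by (intro sum_mono2) (auto intro: off_diag)
    finally show ?thesis using True diag_neg[of i] by simp
  next
    case False
    then have "(\<Sum>j\<in>?A. q i j * 1) = act (\<lambda>_. 1) i" by (intro act_eq[symmetric, of _ s]) auto
    then show ?thesis using False by (simp add: act_const)
  qed
  \<comment> \<open>Summing the balance equations over all columns equates the total exit flow with
    the mass 1 of \<open>a\<close>.\<close>
  have "- 1 = (\<Sum>j\<in>?A. (\<Sum>i\<in>?A. y (Suc s) i * q i j))"
    using a_sum_N[of "\<lambda>_. 1" "Suc s"] by (simp add: y_balance sum_negf a_sum)
  also have "\<dots> = (\<Sum>i\<in>?A. y (Suc s) i * (\<Sum>j\<in>?A. q i j))"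
    unfolding sum_distrib_left by (rule sum.swap)
  also have "\<dots> \<ge> (\<Sum>i\<in>?A. y (Suc s) i * - (of_bool (N s \<le> i) * \<bar>q i i\<bar>))"
    using ge by (intro sum_mono mult_left_mono y_nonneg) auto
  also have "(\<Sum>i\<in>?A. y (Suc s) i * - (of_bool (N s \<le> i) * \<bar>q i i\<bar>)) =
      - (\<Sum>i\<in>{N s..<N (Suc s)}. y (Suc s) i * \<bar>q i i\<bar>)"
    unfolding sum_negf[symmetric]
    by (rule sum.mono_neutral_cong_right) auto
  finally show ?thesis by simp
qed

lemma mass_at_top: "filterlim mass at_top sequentially"
proof -
  have "\<exists>s. mass s \<ge> K" for K
  proof (rule ccontr)
    assume "\<not> ?thesis"
    then have K: "mass s \<le> K" for s by (meson linear)
    define M where "M = (\<Sum>i<N 0. a i * v i) + b * K"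
    text \<open>Each of the \<open>t\<close> blocks contributes at least 1 to the bounded jump rate.\<close>
    have M: "real t \<le> M" for t
    proof -
      have "real t \<le> (\<Sum>s<t. \<Sum>i\<in>{N s..<N (Suc s)}. y (Suc s) i * \<bar>q i i\<bar>)"
        using sum_mono[of "{..<t}" "\<lambda>_. 1", OF exit_flow] by simp
      \<comment> \<open>Monotonicity replaces the rows \<open>y (Suc s)\<close> by the single row
        \<open>y t\<close>.\<close>
      also have "\<dots> \<le> (\<Sum>s<t. \<Sum>i\<in>{N s..<N (Suc s)}. y t i * \<bar>q i i\<bar>)"
        by (intro sum_mono mult_right_mono y_mono') auto
      also have "\<dots> = (\<Sum>i\<in>{N 0..<N t}. y t i * \<bar>q i i\<bar>)"
      \<comment> \<open>The row index \<open>t\<close> is also the induction variable; generalizing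
        over \<open>y\<close> and instantiating it with a constant family keeps the row
        fixed.\<close>
      proof (induction t arbitrary: y)
        case (Suc t)
        have "(\<Sum>i\<in>{N 0..<N t}. y t i * \<bar>q i i\<bar>) + (\<Sum>i\<in>{N t..<N (Suc t)}. y t i * \<bar>q i i\<bar>)
            = (\<Sum>i\<in>{N 0..<N (Suc t)}. y t i * \<bar>q i i\<bar>)" for y :: "nat \<Rightarrow> nat \<Rightarrow> real"
          by (intro sum.atLeastLessThan_concat N_mono) auto
        from this[of "\<lambda>_. y (Suc t)"] Suc[of "\<lambda>_. y (Suc t)"] show ?case by simp
      qed simp
      also have "\<dots> \<le> (\<Sum>i<N t. y t i * \<bar>q i i\<bar>)"
        by (intro sum_mono2) (auto intro!: mult_nonneg_nonneg y_nonneg)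
      also have "\<dots> \<le> M"
      proof -
        have "b * mass t \<le> b * K" using K b_pos by (intro mult_left_mono) auto
        then show ?thesis using jump_rate_bound[of t] by (simp add: M_def)
      qed
      finally show ?thesis .
    qed
    obtain t where "M < real t" using reals_Archimedean2 by blast
    with M[of t] show False by simp
  qed
  then show ?thesis
    unfolding filterlim_at_top eventually_sequentially
    by (meson incseqD mass_mono order_trans)
qed

text \<open>On \<open>C - {j}\<close> the function \<open>u\<close> is strictly superharmonic, so a
  large multiple of it absorbs the excess \<open>b\<close>; at the remaining states other than
  \<open>j\<close> it does no harm.\<close>

lemma lyapunov_exists:
  obtains V where "\<And>i. V i \<ge> 0" "\<And>i. i \<noteq> j \<Longrightarrow> act V i \<le> - 1"
proof -
  obtain u where u: "\<And>i. u i \<ge> 0" "\<And>i. i \<noteq> j \<Longrightarrow> u i > 0"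
    "\<And>i. i \<noteq> j \<Longrightarrow> act u i \<le> 0" "\<And>i. i \<in> C - {j} \<Longrightarrow> act u i < 0"
    by (rule superharmonic_exists[OF C_finite, of j]) auto
  \<comment> \<open>The sum dominates each single quotient and also covers an empty
    \<open>C - {j}\<close>.\<close>
  define K where "K = (\<Sum>i\<in>C - {j}. b / - act u i)"
  have term0: "b / - act u i \<ge> 0" if "i \<in> C - {j}" for i
    using u(4)[OF that] b_pos by (intro divide_nonneg_pos) auto
  have K0: "K \<ge> 0" unfolding K_def using term0 by (rule sum_nonneg)
  show ?thesis
  proof (rule that[of "\<lambda>i. v i + K * u i"])
    show "v i + K * u i \<ge> 0" for i
      using K0 u(1)[of i] v_ge_1[of i] by (simp add: add_nonneg_nonneg)
    fix i assume ij: "i \<noteq> j"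
    have "act v i + K * act u i \<le> - 1"
    proof (cases "i \<in> C")
      case True
      then have iC: "i \<in> C - {j}" using ij by simp
      have "b / - act u i \<le> K"
        unfolding K_def using iC C_finite term0 by (intro member_le_sum) auto
      then have "b \<le> K * - act u i" using u(4)[OF iC] by (simp add: field_simps)
      then show ?thesis using drift[of i] True by simp
    next
      case False
      then show ?thesis
        using drift[of i] mult_nonneg_nonpos[OF K0 u(3)[OF ij]] by simp
    qed
    then show "act (\<lambda>i. v i + K * u i) i \<le> - 1" by (simp add: act_add_scale)
  qed
qed

section \<open>Comparison with the stationary distribution\<close>

lemma pi_pos: "\<pi> i > 0" and pi_balance: "((\<lambda>i. \<pi> i * q i j) has_sum 0) UNIV"
  and pi_sum: "(\<pi> has_sum 1) UNIV"
  using stationary by (auto simp: stationary_distribution_def)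

lemma pi_sum_le: "finite A \<Longrightarrow> (\<Sum>i\<in>A. \<pi> i) \<le> 1"
  by (rule finite_sum_le_has_sum[OF pi_sum]) (auto simp: less_imp_le[OF pi_pos])

lemma pi_truncated_balance:
  assumes "finite A" "j \<in> A"
  shows "(\<Sum>i\<in>A. \<pi> i * q i j) \<le> 0"
  by (rule finite_sum_le_has_sum[OF pi_balance])
     (use assms in \<open>auto intro!: mult_nonneg_nonneg off_diag less_imp_le[OF pi_pos]\<close>)

text \<open>
  The positive part \<open>p\<close> of \<open>y s - c \<pi>\<close>, where \<open>c = y s j / \<pi> j\<close>, vanishes in \<open>j\<close> and satisfies
  \<open>p Q \<ge> - a\<close> elsewhere, so testing with the Lyapunov function bounds its mass.
\<close>
lemma mass_le:
  obtains K where "\<And>s. j < N s \<Longrightarrow> mass s \<le> y s j / \<pi> j + K"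
proof -
  obtain V where V: "\<And>i. V i \<ge> 0" "\<And>i. i \<noteq> j \<Longrightarrow> act V i \<le> - 1"
    by (rule lyapunov_exists[of j]) blast
  show ?thesis
  proof (rule that[of "\<Sum>i<N 0. a i * V i"])
    fix s assume j: "j < N s"
    let ?A = "{..<N s}"
    define c where "c = y s j / \<pi> j"
    have c0: "c \<ge> 0" unfolding c_def using y_nonneg[OF j] pi_pos[of j] by simp
    define z where "z i = y s i - c * \<pi> i" for i
    define p where "p i = max 0 (z i)" for i
    have p0: "p i \<ge> 0" for i by (simp add: p_def)
    have pj: "p j = 0" using pi_pos[of j] by (simp add: p_def z_def c_def)
    \<comment> \<open>The truncated column sums of \<open>\<pi> Q\<close> are at most 0, so
      subtracting \<open>c * \<pi>\<close> can only increase the column sums of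
      \<open>y s\<close>.\<close>
    have zq: "- a k \<le> (\<Sum>i\<in>?A. z i * q i k)" if "k \<in> ?A" for k
    proof -
      have "(\<Sum>i\<in>?A. z i * q i k) = - a k - c * (\<Sum>i\<in>?A. \<pi> i * q i k)"
        using that
        by (simp add: z_def left_diff_distrib sum_subtractf y_balance sum_distrib_left mult.assoc)
      moreover have "c * (\<Sum>i\<in>?A. \<pi> i * q i k) \<le> 0"
        using that c0 by (intro mult_nonneg_nonpos pi_truncated_balance) auto
      ultimately show ?thesis by simp
    qed
    have pq: "- a k \<le> (\<Sum>i\<in>?A. p i * q i k)" if k: "k \<in> ?A" for k
    proof (cases "z k > 0")
      case True
      note zq[OF k]
      also have "(\<Sum>i\<in>?A. z i * q i k) \<le> (\<Sum>i\<in>?A. p i * q i k)"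
      proof (rule sum_mono)
        fix i
        show "z i * q i k \<le> p i * q i k"
          using True off_diag[of i k]
          by (cases "i = k") (auto simp: p_def intro!: mult_right_mono)
      qed
      finally show ?thesis .
    next
      case False
      have "0 \<le> (\<Sum>i\<in>?A. p i * q i k)"
      proof (rule sum_nonneg)
        fix i
        show "0 \<le> p i * q i k"
          using False off_diag[of i k] p0[of i] by (cases "i = k") (auto simp: p_def)
      qed
      then show ?thesis using a_nonneg[of k] by simp
    qed
    have "- (\<Sum>i<N 0. a i * V i) = (\<Sum>k\<in>?A. - a k * V k)"
      using a_sum_N[of V s] by (simp add: sum_negf)
    also have "\<dots> \<le> (\<Sum>k\<in>?A. (\<Sum>i\<in>?A. p i * q i k) * V k)"
      using pq V(1) by (intro sum_mono mult_right_mono) auto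
    also have "\<dots> = (\<Sum>i\<in>?A. p i * (\<Sum>k\<in>?A. q i k * V k))"
      unfolding sum_distrib_left sum_distrib_right by (subst sum.swap) (simp add: mult_ac)
    also have "\<dots> \<le> (\<Sum>i\<in>?A. - p i)"
    proof (rule sum_mono)
      fix i assume i: "i \<in> ?A"
      show "p i * (\<Sum>k\<in>?A. q i k * V k) \<le> - p i"
      \<comment> \<open>The Lyapunov inequality may fail at \<open>j\<close>, but \<open>p\<close>
        vanishes there.\<close>
      proof (cases "i = j")
        case False
        have "(\<Sum>k\<in>?A. q i k * V k) \<le> act V i" using i V(1) by (intro truncated_act_le) auto
        also have "\<dots> \<le> - 1" by (rule V(2)[OF False])
        finally have "(\<Sum>k\<in>?A. q i k * V k) \<le> - 1" .
        from mult_left_mono[OF this p0[of i]] show ?thesis by simp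
      qed (simp add: pj)
    qed
    finally have p_sum: "(\<Sum>i\<in>?A. p i) \<le> (\<Sum>i<N 0. a i * V i)" by (simp add: sum_negf)
    \<comment> \<open>The row \<open>y s\<close> is at most \<open>c * \<pi> + p\<close>, and
      \<open>\<pi>\<close> has mass at most 1 on a finite set.\<close>
    have "mass s \<le> (\<Sum>i\<in>?A. c * \<pi> i + p i)"
      unfolding mass_def by (intro sum_mono) (auto simp: p_def z_def)
    also have "\<dots> \<le> c + (\<Sum>i<N 0. a i * V i)"
      using p_sum mult_left_mono[OF pi_sum_le[of ?A] c0]
      by (simp add: sum.distrib flip: sum_distrib_left)
    finally show "mass s \<le> y s j / \<pi> j + (\<Sum>i<N 0. a i * V i)" by (simp add: c_def)
  qed
qed

lemma eventually_less_N: "\<forall>\<^sub>F s in sequentially. j < N s"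
  unfolding eventually_sequentially
  by (rule exI[of _ "Suc j"]) (meson N_mono less_N less_le_trans)

lemma eventually_mass_pos: "\<forall>\<^sub>F s in sequentially. 0 < mass s"
  using mass_at_top by (simp add: filterlim_at_top_dense)

text \<open>Multiplying \<open>mass_le\<close> by \<open>\<pi> j / mass s\<close> leaves the error
  \<open>K * \<pi> j / mass s\<close>, which vanishes because the mass diverges.\<close>

lemma eventually_share_ge:
  assumes "e > 0"
  shows "\<forall>\<^sub>F s in sequentially. \<pi> j - e \<le> y s j / mass s"
proof -
  obtain K where K: "\<And>s. j < N s \<Longrightarrow> mass s \<le> y s j / \<pi> j + K" by (rule mass_le[of j]) blast
  have "((\<lambda>s. K * \<pi> j / mass s) \<longlongrightarrow> 0) sequentially"
    by (rule real_tendsto_divide_at_top[OF tendsto_const mass_at_top])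
  then have "\<forall>\<^sub>F s in sequentially. K * \<pi> j / mass s < e"
    using assms by (rule order_tendstoD)
  then show ?thesis using eventually_less_N[of j] eventually_mass_pos
  proof eventually_elim
    case (elim s)
    from K[OF elim(2)] have "mass s * \<pi> j \<le> y s j + K * \<pi> j"
      using pi_pos[of j] by (simp add: field_simps)
    then have "\<pi> j \<le> y s j / mass s + K * \<pi> j / mass s"
      using elim(3) by (simp add: field_simps)
    then show ?case using elim(1) by simp
  qed
qed

theorem share_tendsto: "(\<lambda>s. y s j / mass s) \<longlonglongrightarrow> \<pi> j"
proof (rule tendstoI)
  fix e :: real assume e: "e > 0"
  have "\<exists>F. finite F \<and> F \<subseteq> UNIV \<and> dist (sum \<pi> F) 1 \<le> e / 4"
    using has_sum_finite_approximation[OF pi_sum, of "e / 4"] e by auto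
  then obtain F where F: "finite F" "dist (sum \<pi> F) 1 \<le> e / 4" by blast
  define G where "G = F - {j}"
  have G: "finite G" "j \<notin> G" using F by (auto simp: G_def)
  have "sum \<pi> F \<le> \<pi> j + sum \<pi> G"
  proof -
    have "sum \<pi> F \<le> sum \<pi> (insert j G)"
      using F by (intro sum_mono2) (auto simp: G_def less_imp_le[OF pi_pos])
    then show ?thesis using G by simp
  qed
  then have piG: "1 - e / 4 \<le> \<pi> j + sum \<pi> G"
    using F(2) by (simp add: dist_real_def abs_if split: if_splits)
  \<comment> \<open>The \<open>card G\<close> lower bounds lose at most \<open>e / 4\<close>
    together, and the tail of \<open>\<pi>\<close> outside \<open>F\<close> another
    \<open>e / 4\<close>; the summand 1 avoids division by 0 for empty \<open>G\<close>.\<close>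
  define d where "d = e / (4 * (1 + card G))"
  have d: "d > 0" "card G * d \<le> e / 4" using e by (auto simp: d_def field_simps)
  have "\<forall>\<^sub>F s in sequentially. \<forall>i\<in>G. \<pi> i - d \<le> y s i / mass s \<and> i < N s"
    using G(1) by (intro eventually_ball_finite ballI eventually_conj eventually_share_ge d eventually_less_N)
  moreover have "\<forall>\<^sub>F s in sequentially. \<pi> j - e / 2 \<le> y s j / mass s"
    using e by (intro eventually_share_ge) simp
  ultimately show "\<forall>\<^sub>F s in sequentially. dist (y s j / mass s) (\<pi> j) < e"
    using eventually_less_N[of j] eventually_mass_pos
  proof eventually_elim
    case (elim s)
    have "(\<Sum>i\<in>insert j G. y s i) \<le> mass s"
      unfolding mass_def using elim G by (intro sum_mono2 y_nonneg) auto
    then have "(\<Sum>i\<in>insert j G. y s i) / mass s \<le> 1" using elim by (simp add: field_simps)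
    then have 1: "y s j / mass s + (\<Sum>i\<in>G. y s i / mass s) \<le> 1"
      using G by (simp add: add_divide_distrib sum_divide_distrib)
    have "sum \<pi> G - card G * d = (\<Sum>i\<in>G. \<pi> i - d)" by (simp add: sum_subtractf)
    also have "\<dots> \<le> (\<Sum>i\<in>G. y s i / mass s)" using elim by (intro sum_mono) auto
    finally have "y s j / mass s \<le> \<pi> j + e / 2" using 1 d piG by linarith
    then show ?case using elim(2) e by (auto simp: dist_real_def abs_if)
  qed
qed

end

section \<open>The blocks of the truncations\<close>

definition nonneg_mat :: "real mat \<Rightarrow> bool" where
  "nonneg_mat A \<longleftrightarrow> (\<forall>i<dim_row A. \<forall>j<dim_col A. A $$ (i, j) \<ge> 0)"

lemma nonneg_matD: "nonneg_mat A \<Longrightarrow> A \<in> carrier_mat nr nc \<Longrightarrow> i < nr \<Longrightarrow> j < nc \<Longrightarrow> A $$ (i, j) \<ge> 0"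
  by (auto simp: nonneg_mat_def)

lemma mult_mat_index:
  "A \<in> carrier_mat nr n \<Longrightarrow> B \<in> carrier_mat n nc \<Longrightarrow> i < nr \<Longrightarrow> j < nc \<Longrightarrow>
    (A * B) $$ (i, j) = (\<Sum>k<n. A $$ (i, k) * B $$ (k, j))"
  by (auto simp: scalar_prod_def lessThan_atLeast0)

lemma nonneg_mat_mult:
  assumes "nonneg_mat A" "nonneg_mat B" "A \<in> carrier_mat nr n" "B \<in> carrier_mat n nc"
  shows "nonneg_mat (A * B)"
  unfolding nonneg_mat_def
proof (intro allI impI)
  fix i j assume "i < dim_row (A * B)" "j < dim_col (A * B)"
  then have ij: "i < nr" "j < nc" using assms by auto
  have "0 \<le> (\<Sum>k<n. A $$ (i, k) * B $$ (k, j))"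
    using ij by (intro sum_nonneg mult_nonneg_nonneg nonneg_matD[OF assms(1,3)]
        nonneg_matD[OF assms(2,4)]) auto
  then show "(A * B) $$ (i, j) \<ge> 0" using ij by (simp only: mult_mat_index[OF assms(3,4)])
qed

lemma mat_sum_carrier [simp]: "mat_sum nr nc F A \<in> carrier_mat nr nc"
  by (simp add: mat_sum_def)

lemma mat_sum_index [simp]:
  "i < nr \<Longrightarrow> j < nc \<Longrightarrow> mat_sum nr nc F A $$ (i, j) = (\<Sum>a\<in>A. F a $$ (i, j))"
  by (simp add: mat_sum_def)

lemma mult_mat_sum:
  assumes "M \<in> carrier_mat nr n" "\<And>a. a \<in> A \<Longrightarrow> F a \<in> carrier_mat n nc"
  shows "M * mat_sum n nc F A = mat_sum nr nc (\<lambda>a. M * F a) A"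
proof (rule eq_matI)
  fix i j assume "i < dim_row (mat_sum nr nc (\<lambda>a. M * F a) A)"
    "j < dim_col (mat_sum nr nc (\<lambda>a. M * F a) A)"
  then have ij: "i < nr" "j < nc" by (auto simp: mat_sum_def)
  have "(M * mat_sum n nc F A) $$ (i, j) = (\<Sum>k<n. \<Sum>a\<in>A. M $$ (i, k) * F a $$ (k, j))"
    using ij by (simp add: mult_mat_index[OF assms(1) mat_sum_carrier] sum_distrib_left
        del: index_mult_mat)
  also have "\<dots> = (\<Sum>a\<in>A. (M * F a) $$ (i, j))"
    using ij by (subst sum.swap) (simp add: mult_mat_index[OF assms] del: index_mult_mat)
  finally show "(M * mat_sum n nc F A) $$ (i, j) = mat_sum nr nc (\<lambda>a. M * F a) A $$ (i, j)"
    using ij by simp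
qed (use assms in \<open>auto simp: mat_sum_def\<close>)

text \<open>By \<open>Z_matrix_row_nonneg\<close> for \<open>- U\<close>, a row \<open>z\<close>
  with \<open>z U \<ge> 0\<close> is nonnegative. Applied to a left null vector and its negative
  this gives invertibility; applied to the rows of the inverse, their nonnegativity.\<close>

lemma mat_inv_M_matrix:
  fixes U :: "real mat"
  assumes U: "U \<in> carrier_mat n n"
    and off: "\<And>i j. i < n \<Longrightarrow> j < n \<Longrightarrow> i \<noteq> j \<Longrightarrow> U $$ (i, j) \<le> 0"
    and w: "\<And>i. i < n \<Longrightarrow> w i > 0"
    and Uw: "\<And>i. i < n \<Longrightarrow> (\<Sum>j<n. U $$ (i, j) * w j) > 0"
  shows "mat_inv U \<in> carrier_mat n n \<and> mat_inv U * U = 1\<^sub>m n \<and> nonneg_mat (mat_inv U)"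
proof -
  have row_nonneg: "z i \<ge> 0"
    if "\<And>j. j < n \<Longrightarrow> (\<Sum>i<n. z i * U $$ (i, j)) \<ge> 0" "i < n" for z i
    by (rule Z_matrix_row_nonneg[where A = "{..<n}" and T = "\<lambda>i j. - U $$ (i, j)" and w = w])
       (use that off w Uw in \<open>auto simp: sum_negf\<close>)
  have "det (transpose_mat U) \<noteq> 0"
  proof
    assume "det (transpose_mat U) = 0"
    then obtain x where x: "x \<in> carrier_vec n" "x \<noteq> 0\<^sub>v n" "transpose_mat U *\<^sub>v x = 0\<^sub>v n"
      using det_0_iff_vec_prod_zero_field[of "transpose_mat U" n] U by auto
    have xU: "(\<Sum>i<n. x $ i * U $$ (i, j)) = 0" if "j < n" for j
    proof -
      have "(transpose_mat U *\<^sub>v x) $ j = (\<Sum>i<n. x $ i * U $$ (i, j))"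
        using that U x(1) by (simp add: scalar_prod_def lessThan_atLeast0 mult.commute)
      then show ?thesis using x(3) that by simp
    qed
    have "x $ i = 0" if "i < n" for i
      using row_nonneg[of "\<lambda>i. x $ i" i] row_nonneg[of "\<lambda>i. - x $ i" i] that xU
      by (simp add: sum_negf)
    then have "x = 0\<^sub>v n" using x(1) by (intro eq_vecI) auto
    then show False using x(2) by simp
  qed
  then have "det U \<noteq> 0" using det_transpose[OF U] by simp
  then have "U \<in> Units (ring_mat TYPE(real) n ())" by (rule det_non_zero_imp_unit[OF U])
  then obtain V where "mat_inverse U = Some V" using mat_inverse(1)[OF U] by fastforce
  with mat_inverse(2)[OF U this] have V: "mat_inv U = V" "V * U = 1\<^sub>m n" "V \<in> carrier_mat n n"
    by (auto simp: mat_inv_def)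
  have "V $$ (i, j) \<ge> 0" if "i < n" "j < n" for i j
  proof (rule row_nonneg[where z = "\<lambda>j. V $$ (i, j)"])
    fix l assume "l < n"
    then have "(\<Sum>k<n. V $$ (i, k) * U $$ (k, l)) = 1\<^sub>m n $$ (i, l)"
      using that by (simp add: V(2) flip: mult_mat_index[OF V(3) U])
    then show "0 \<le> (\<Sum>k<n. V $$ (i, k) * U $$ (k, l))"
      using that \<open>l < n\<close> by simp
  qed fact
  then show ?thesis using V by (auto simp: nonneg_mat_def)
qed

section \<open>Levels, their states and concatenated rows\<close>

locale block_generator =
  fixes m :: "nat \<Rightarrow> nat" and q :: "nat \<Rightarrow> nat \<Rightarrow> real"
  assumes m_pos: "\<And>k. m k > 0"
    and stable: "stable_conservative q"
    and irreducible: "irreducible_generator q"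
    and hessenberg: "lower_block_Hessenberg m q"
begin

abbreviation L :: "nat \<Rightarrow> nat" where "L \<equiv> level_start m"

abbreviation Q :: "nat \<Rightarrow> nat \<Rightarrow> real mat" where "Q \<equiv> Qblock m q"

lemma L_Suc: "L (Suc k) = L k + m k"
  by (simp add: level_start_def)

lemma L_0: "L 0 = 0"
  by (simp add: level_start_def)

lemma L_strict_mono: "strict_mono L"
  using m_pos by (auto simp: strict_mono_Suc_iff L_Suc)

lemma L_mono: "k \<le> l \<Longrightarrow> L k \<le> L l"
  using L_strict_mono by (simp add: strict_mono_less_eq)

definition lev :: "nat \<Rightarrow> nat" where "lev t = (LEAST l. t < L (Suc l))"

lemma lev_block: "j < m l \<Longrightarrow> lev (L l + j) = l"
  unfolding lev_def
proof (rule Least_equality)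
  fix k assume "j < m l" "L l + j < L (Suc k)"
  then show "l \<le> k" using L_mono[of "Suc k" l] by (cases "l \<le> k") auto
qed (simp add: L_Suc)

lemma block_decomp: "L (lev t) \<le> t" "t < L (lev t) + m (lev t)"
proof -
  have "t < L (Suc t)" using strict_mono_imp_increasing[OF L_strict_mono, of "Suc t"] by simp
  then have 1: "t < L (Suc (lev t))" unfolding lev_def by (rule LeastI)
  then show "t < L (lev t) + m (lev t)" by (simp add: L_Suc)
  show "L (lev t) \<le> t"
  proof (cases "lev t")
    case (Suc k)
    then have "\<not> t < L (Suc k)" using not_less_Least[of k "\<lambda>l. t < L (Suc l)"] by (simp add: lev_def)
    then show ?thesis using Suc by simp
  qed (simp add: L_0)
qed

lemma block_cases:
  obtains l j where "t = L l + j" "j < m l" "lev t = l"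
  using that[of "lev t" "t - L (lev t)"] block_decomp[of t] by simp

lemma lev_less_iff: "lev t < k \<longleftrightarrow> t < L k"
proof
  assume "lev t < k"
  then show "t < L k" using block_decomp(2)[of t] L_mono[of "Suc (lev t)" k] by (simp add: L_Suc)
next
  assume "t < L k"
  then show "lev t < k" using block_decomp(1)[of t] L_mono[of k "lev t"] by (cases "lev t < k") auto
qed

lemma Q_carrier [simp]: "Q k l \<in> carrier_mat (m k) (m l)"
  by (simp add: Qblock_def)

lemma Q_index: "i < m k \<Longrightarrow> j < m l \<Longrightarrow> Q k l $$ (i, j) = q (L k + i) (L l + j)"
  by (simp add: Qblock_def)

text \<open>The value \<open>L (Suc s)\<close> counts the states of the levels 0 to
  \<open>s\<close>, which form the truncation behind \<open>Rstar m q s\<close>.\<close>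

sublocale banded_generator q "\<lambda>s. L (Suc s)"
proof
  show "strict_mono (\<lambda>s. L (Suc s))"
    using L_strict_mono by (simp add: strict_mono_Suc_iff)
  fix s i j assume "i < L (Suc s)" "L (Suc (Suc s)) \<le> j"
  then have lev: "lev i < Suc s" "\<not> lev j < Suc (Suc s)" by (simp_all add: lev_less_iff)
  obtain k i' where i: "i = L k + i'" "i' < m k" "lev i = k" by (rule block_cases)
  obtain l j' where j: "j = L l + j'" "j' < m l" "lev j = l" by (rule block_cases)
  have "Q k l = 0\<^sub>m (m k) (m l)"
    using hessenberg lev i j by (simp add: lower_block_Hessenberg_def)
  then show "q i j = 0" using Q_index[OF i(2) j(2)] i j by simp
qed (fact stable irreducible)+

lemma sum_blocks: "(\<Sum>t<L s. f t) = (\<Sum>l<s. \<Sum>j<m l. f (L l + j) :: real)"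
proof (induction s)
  case (Suc s)
  have "(\<Sum>t<L (Suc s). f t) = (\<Sum>t<L s. f t) + (\<Sum>t\<in>{L s..<L s + m s}. f t)"
    unfolding L_Suc lessThan_atLeast0 by (rule sum.atLeastLessThan_concat[symmetric]) auto
  also have "(\<Sum>t\<in>{L s..<L s + m s}. f t) = (\<Sum>j<m s. f (L s + j))"
    unfolding lessThan_atLeast0
    using sum.shift_bounds_nat_ivl[of f 0 "L s" "m s"] by (simp add: add.commute)
  finally show ?case using Suc by simp
qed (simp add: L_0)

definition glue :: "(nat \<Rightarrow> real mat) \<Rightarrow> nat \<Rightarrow> real" where
  "glue F t = F (lev t) $$ (0, t - L (lev t))"

lemma glue_block: "j < m l \<Longrightarrow> glue F (L l + j) = F l $$ (0, j)"
  by (simp add: glue_def lev_block)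

lemma glue_mult:
  assumes "\<And>l. l < s \<Longrightarrow> F l \<in> carrier_mat 1 (m l)" "u < m j"
  shows "(\<Sum>t<L s. glue F t * q t (L j + u)) = (\<Sum>l<s. (F l * Q l j) $$ (0, u))"
  unfolding sum_blocks
proof (rule sum.cong)
  fix l assume "l \<in> {..<s}"
  then have "(F l * Q l j) $$ (0, u) = (\<Sum>i<m l. F l $$ (0, i) * Q l j $$ (i, u))"
    using assms(2) by (intro mult_mat_index[OF assms(1) Q_carrier]) auto
  also have "\<dots> = (\<Sum>i<m l. glue F (L l + i) * q (L l + i) (L j + u))"
    using assms(2) by (simp add: glue_block Q_index)
  finally show "(\<Sum>i<m l. glue F (L l + i) * q (L l + i) (L j + u)) = (F l * Q l j) $$ (0, u)" ..
qed simp

section \<open>R-matrices as inverses of Schur complements\<close>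

abbreviation Rs :: "nat \<Rightarrow> nat \<Rightarrow> real mat" where "Rs \<equiv> Rstar m q"

abbreviation Rb :: "nat \<Rightarrow> nat \<Rightarrow> nat \<Rightarrow> real mat" where "Rb \<equiv> Rblock m q"

text \<open>\<open>U s k\<close> is the Schur complement whose inverse is \<open>Rs s k\<close>.\<close>
definition U :: "nat \<Rightarrow> nat \<Rightarrow> real mat" where
  "U s k = - Q k k - mat_sum (m k) (m k) (\<lambda>l. Rb s k l * Q l k) {k+1..s}"

lemma U_carrier [simp]: "U s k \<in> carrier_mat (m k) (m k)"
  unfolding U_def by (intro minus_carrier_mat) simp

text \<open>This collects what the downward recursion needs from a level. The inverse is recorded on
  the left because rows are multiplied by \<open>Rs s k\<close> first and then by
  \<open>U s k\<close>.\<close>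

definition regular :: "nat \<Rightarrow> nat \<Rightarrow> bool" where
  "regular s k \<longleftrightarrow> Rs s k \<in> carrier_mat (m k) (m k) \<and> Rs s k * U s k = 1\<^sub>m (m k) \<and>
     nonneg_mat (Rs s k)"

lemma Rb_self: "Rb s k k = 1\<^sub>m (m k)"
  by (simp add: Rblock_def mat_prod_def)

lemma Rb_Suc: "k \<le> l \<Longrightarrow> Rb s k (Suc l) = Rb s k l * (Q l (Suc l) * Rs s (Suc l))"
  by (simp add: Rblock_def mat_prod_def)

lemma Q_Rs_carrier: "regular s (Suc l) \<Longrightarrow> Q l (Suc l) * Rs s (Suc l) \<in> carrier_mat (m l) (m (Suc l))"
  by (rule mult_carrier_mat[OF Q_carrier]) (simp add: regular_def)

lemma Q_off_nonneg: "k \<noteq> l \<Longrightarrow> nonneg_mat (Q k l)"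
proof -
  assume "k \<noteq> l"
  then have "L k + i \<noteq> L l + j" if "i < m k" "j < m l" for i j
    using lev_block[OF that(1)] lev_block[OF that(2)] by metis
  then show ?thesis
    unfolding nonneg_mat_def using off_diag by (auto simp: Q_index Qblock_def)
qed

lemma Rb_carrier_nonneg:
  assumes "k \<le> l" "\<And>j. k < j \<Longrightarrow> j \<le> l \<Longrightarrow> regular s j"
  shows "Rb s k l \<in> carrier_mat (m k) (m l) \<and> nonneg_mat (Rb s k l)"
  using assms
proof (induction rule: dec_induct)
  case base
  show ?case by (auto simp: Rb_self nonneg_mat_def)
next
  case (step l)
  then have IH: "Rb s k l \<in> carrier_mat (m k) (m l)" "nonneg_mat (Rb s k l)" and
    reg: "regular s (Suc l)" by auto
  have "nonneg_mat (Q l (Suc l) * Rs s (Suc l))"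
    by (rule nonneg_mat_mult[OF Q_off_nonneg _ Q_carrier]) (use reg in \<open>auto simp: regular_def\<close>)
  then show ?case
    using IH step.hyps Q_Rs_carrier[OF reg] by (auto simp: Rb_Suc intro: nonneg_mat_mult)
qed

lemma Rb_split:
  assumes "k \<le> j" "j \<le> l" "\<And>i. k < i \<Longrightarrow> i \<le> l \<Longrightarrow> regular s i"
  shows "Rb s k l = Rb s k j * Rb s j l"
  using assms(2,3)
proof (induction rule: dec_induct)
  case base
  then have "Rb s k j \<in> carrier_mat (m k) (m j)" using Rb_carrier_nonneg assms(1) by blast
  then show ?case by (simp add: Rb_self)
next
  case (step l)
  have c: "Rb s k j \<in> carrier_mat (m k) (m j)" "Rb s j l \<in> carrier_mat (m j) (m l)"
    using Rb_carrier_nonneg[of k j s] Rb_carrier_nonneg[of j l s] step assms(1) by auto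
  have d: "Q l (Suc l) * Rs s (Suc l) \<in> carrier_mat (m l) (m (Suc l))"
    using step assms(1) by (intro Q_Rs_carrier) auto
  show ?case using step assms(1) c d by (simp add: Rb_Suc assoc_mult_mat[OF c d])
qed

text \<open>A row with block \<open>X\<close> at level \<open>k\<close>, continued upwards so that
  it is balanced at the levels above \<open>k\<close>. Unit rows \<open>X\<close> serve to invert
  \<open>U s k\<close>; the case \<open>k = 0\<close> gives the occupation row.\<close>

definition row_family :: "nat \<Rightarrow> nat \<Rightarrow> real mat \<Rightarrow> nat \<Rightarrow> real mat" where
  "row_family s k X l = (if k \<le> l then X * Rb s k l else 0\<^sub>m 1 (m l))"

text \<open>Regularity is assumed only strictly above \<open>k\<close>, so these facts are available
  while that of level \<open>k\<close> itself is being proved.\<close>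

context
  fixes s k :: nat and X :: "real mat"
  assumes k_le: "k \<le> s" and reg: "\<And>j. k < j \<Longrightarrow> j \<le> s \<Longrightarrow> regular s j"
    and X: "X \<in> carrier_mat 1 (m k)"
begin

lemma row_family_carrier: "l \<le> s \<Longrightarrow> row_family s k X l \<in> carrier_mat 1 (m l)"
  using Rb_carrier_nonneg[of k l s] reg X by (auto simp: row_family_def)

lemma row_family_start: "row_family s k X k = X"
  using X by (simp add: row_family_def Rb_self)

lemma row_family_nonneg: "nonneg_mat X \<Longrightarrow> l \<le> s \<Longrightarrow> nonneg_mat (row_family s k X l)"
  using Rb_carrier_nonneg[of k l s] reg X
  by (auto simp: row_family_def intro: nonneg_mat_mult) (simp add: nonneg_mat_def)

text \<open>By \<open>Rb_split\<close> each block beyond \<open>j\<close> factors through the block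
  at \<open>j\<close>; what multiplies the latter is \<open>Q j j\<close> plus the sum in the Schur
  complement, that is \<open>- U s j\<close>.\<close>

lemma row_family_Schur:
  assumes "k \<le> j" "j \<le> s" "u < m j"
  shows "(\<Sum>l\<in>{j..s}. (row_family s k X l * Q l j) $$ (0, u)) = - (row_family s k X j * U s j) $$ (0, u)"
proof -
  let ?F = "row_family s k X"
  have Fj: "?F j \<in> carrier_mat 1 (m j)" using assms by (intro row_family_carrier)
  have Rbc: "Rb s j l \<in> carrier_mat (m j) (m l)" if "l \<in> {j+1..s}" for l
    using Rb_carrier_nonneg[of j l s] reg assms that by auto
  have F: "?F l * Q l j = ?F j * (Rb s j l * Q l j)" if l: "l \<in> {j+1..s}" for l
  proof -
    have "?F l = X * (Rb s k j * Rb s j l)"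
      using Rb_split[of k j l s] reg assms l by (simp add: row_family_def)
    also have "\<dots> = ?F j * Rb s j l"
      using assoc_mult_mat[OF X _ Rbc[OF l], of "Rb s k j"] Rb_carrier_nonneg[of k j s] reg assms
      by (simp add: row_family_def)
    finally show ?thesis using assoc_mult_mat[OF Fj Rbc[OF l] Q_carrier] by simp
  qed
  define M where "M = mat_sum (m j) (m j) (\<lambda>l. Rb s j l * Q l j) {j+1..s}"
  have M: "M \<in> carrier_mat (m j) (m j)" by (simp add: M_def)
  have "(\<Sum>l\<in>{j+1..s}. (?F l * Q l j) $$ (0, u)) = (?F j * M) $$ (0, u)"
    unfolding M_def
    using assms F by (subst mult_mat_sum[OF Fj]) (auto intro: mult_carrier_mat[OF Rbc Q_carrier]
        simp del: index_mult_mat intro!: sum.cong)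
  moreover have "{j..s} = insert j {j+1..s}" using assms by auto
  ultimately have "(\<Sum>l\<in>{j..s}. (?F l * Q l j) $$ (0, u)) = (?F j * Q j j) $$ (0, u) + (?F j * M) $$ (0, u)"
    by (simp del: index_mult_mat)
  also have "\<dots> = - (?F j * U s j) $$ (0, u)"
  proof -
    have Ua: "U s j $$ (i, u) = - Q j j $$ (i, u) - M $$ (i, u)" if "i < m j" for i
      using that assms M unfolding U_def M_def[symmetric] by (simp add: carrier_matD[OF Q_carrier])
    have ent: "(?F j * Z) $$ (0, u) = (\<Sum>i<m j. ?F j $$ (0, i) * Z $$ (i, u))"
      if "Z \<in> carrier_mat (m j) (m j)" for Z
      using assms by (intro mult_mat_index[OF Fj that]) auto
    show ?thesis
      unfolding ent[OF M] ent[OF Q_carrier] ent[OF U_carrier]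
      by (simp add: Ua algebra_simps sum.distrib sum_subtractf sum_negf)
  qed
  finally show ?thesis .
qed

text \<open>Levels below \<open>j - 1\<close> cannot reach \<open>j\<close>. The levels from
  \<open>j\<close> on contribute the negative of what level \<open>j - 1\<close> contributes,
  because \<open>Rs s j\<close> cancels \<open>U s j\<close>.\<close>

lemma glue_balance:
  assumes "k < j" "j \<le> s" "u < m j"
  shows "(\<Sum>t<L (Suc s). glue (row_family s k X) t * q t (L j + u)) = 0"
proof -
  let ?F = "row_family s k X"
  obtain p where p: "j = Suc p" "k \<le> p" using assms by (cases j) auto
  have Fp: "?F p \<in> carrier_mat 1 (m p)" using assms p by (intro row_family_carrier) simp
  have r: "Rs s j \<in> carrier_mat (m j) (m j)" "Rs s j * U s j = 1\<^sub>m (m j)"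
    using reg[of j] assms by (auto simp: regular_def)
  have zero: "(?F l * Q l j) $$ (0, u) = 0" if "l < p" for l
  proof -
    have "Q l j = 0\<^sub>m (m l) (m j)" using hessenberg that p by (simp add: lower_block_Hessenberg_def)
    then show ?thesis using row_family_carrier[of l] that assms p by simp
  qed
  have QR: "Q p j * Rs s j \<in> carrier_mat (m p) (m j)"
    by (rule mult_carrier_mat[OF Q_carrier r(1)])
  have "?F j = ?F p * (Q p j * Rs s j)"
    using assoc_mult_mat[OF X _ QR] Rb_carrier_nonneg[of k p s] reg assms p
    by (simp add: row_family_def Rb_Suc)
  then have "?F j * U s j = ?F p * (Q p j * (Rs s j * U s j))"
    using assoc_mult_mat[OF Fp QR U_carrier] assoc_mult_mat[OF Q_carrier r(1) U_carrier] by simp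
  then have FU: "?F j * U s j = ?F p * Q p j" using r right_mult_one_mat[OF Q_carrier] by simp
  have split: "{..<Suc s} = {..<p} \<union> ({p} \<union> {j..s})" using assms p by auto
  have "(\<Sum>t<L (Suc s). glue ?F t * q t (L j + u)) = (\<Sum>l<Suc s. (?F l * Q l j) $$ (0, u))"
    using assms by (intro glue_mult row_family_carrier) auto
  also have "\<dots> = (?F p * Q p j) $$ (0, u) + (\<Sum>l\<in>{j..s}. (?F l * Q l j) $$ (0, u))"
    unfolding split using p zero
    by (subst sum.union_disjoint; auto simp del: index_mult_mat)+
  also have "\<dots> = 0"
    using row_family_Schur[of j u] assms FU by (simp del: index_mult_mat)
  finally show ?thesis .
qed

lemma glue_balance_start:
  assumes "u < m k"
  shows "(\<Sum>t<L (Suc s). glue (row_family s k X) t * q t (L k + u)) = - (X * U s k) $$ (0, u)"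
proof -
  let ?F = "row_family s k X"
  have "(\<Sum>t<L (Suc s). glue ?F t * q t (L k + u)) = (\<Sum>l<Suc s. (?F l * Q l k) $$ (0, u))"
    using assms by (intro glue_mult row_family_carrier) auto
  also have "\<dots> = (\<Sum>l\<in>{k..s}. (?F l * Q l k) $$ (0, u))"
  proof (rule sum.mono_neutral_right)
    show "\<forall>l\<in>{..<Suc s} - {k..s}. (?F l * Q l k) $$ (0, u) = 0"
    proof
      fix l assume "l \<in> {..<Suc s} - {k..s}"
      then have "?F l = 0\<^sub>m 1 (m l)" by (auto simp: row_family_def)
      then show "(?F l * Q l k) $$ (0, u) = 0"
        using assms left_mult_zero_mat[OF Q_carrier] by (simp del: index_mult_mat)
    qed
  qed auto
  finally show ?thesis using row_family_Schur[of k u] assms k_le by (simp add: row_family_start del: index_mult_mat)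
qed

lemma glue_nonneg: "nonneg_mat X \<Longrightarrow> t < L (Suc s) \<Longrightarrow> glue (row_family s k X) t \<ge> 0"
  unfolding glue_def
  using block_decomp[of t] lev_less_iff[of t "Suc s"]
  by (intro nonneg_matD[OF row_family_nonneg row_family_carrier]) auto

end

text \<open>Downward induction on the level: \<open>U s k\<close> is an M-matrix, witnessed by the
  restriction to level \<open>k\<close> of a test vector \<open>w\<close> of the whole
  truncation.\<close>

lemma regular: "k \<le> s \<Longrightarrow> regular s k"
proof (induction "s - k" arbitrary: k rule: less_induct)
  case less
  have reg: "regular s j" if "k < j" "j \<le> s" for j using less that by auto
  obtain w where w: "\<And>i. i < L (Suc s) \<Longrightarrow> w i > 0"
    "\<And>i. i < L (Suc s) \<Longrightarrow> (\<Sum>j<L (Suc s). q i j * w j) < 0"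
    by (rule truncation_test_exists[of "L (Suc s)"]) blast
  have in_trunc: "L k + i < L (Suc s)" if "i < m k" for i
    using that less.prems L_mono[of "Suc k" "Suc s"] by (simp add: L_Suc)
  have "mat_inv (U s k) \<in> carrier_mat (m k) (m k) \<and> mat_inv (U s k) * U s k = 1\<^sub>m (m k) \<and>
    nonneg_mat (mat_inv (U s k))"
  proof (rule mat_inv_M_matrix[where w = "\<lambda>i. w (L k + i)"])
    fix i assume i: "i < m k"
    \<comment> \<open>The unit row \<open>X\<close> selects row \<open>i\<close> of
      \<open>U s k\<close>; its continuation \<open>r\<close> transfers the sum of this row against
      \<open>w\<close> to the truncated generator.\<close>
    define X :: "real mat" where "X = Matrix.mat 1 (m k) (\<lambda>(_, j). of_bool (i = j))"
    have X: "X \<in> carrier_mat 1 (m k)" "nonneg_mat X" by (auto simp: X_def nonneg_mat_def)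
    define r where "r = glue (row_family s k X)"
    note r_facts = glue_nonneg[OF less.prems reg X(1) X(2), folded r_def]
      glue_balance[OF less.prems reg X(1), folded r_def]
      glue_balance_start[OF less.prems reg X(1), folded r_def]
    let ?A = "{..<L (Suc s)}"
    have rk: "r (L k + j) = of_bool (i = j)" if "j < m k" for j
      using that row_family_start[OF less.prems reg X(1)] by (simp add: r_def glue_block X_def)
    have XU: "(X * U s k) $$ (0, u) = U s k $$ (i, u)" if "u < m k" for u
    proof -
      have "(X * U s k) $$ (0, u) = (\<Sum>l<m k. X $$ (0, l) * U s k $$ (l, u))"
        using that by (intro mult_mat_index[OF X(1) U_carrier]) auto
      also have "\<dots> = (\<Sum>l<m k. of_bool (i = l) * U s k $$ (l, u))"
        by (simp add: X_def del: sum_of_bool_mult_eq)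
      also have "\<dots> = U s k $$ (i, u)"
      proof -
        have "{..<m k} \<inter> {l. i = l} = {i}" using i by auto
        then show ?thesis by simp
      qed
      finally show ?thesis .
    qed
    \<comment> \<open>Outside level \<open>k\<close>, the row \<open>r Q\<close> vanishes above
      \<open>k\<close> by balance and is nonnegative below \<open>k\<close>, where \<open>r\<close>
      itself is zero.\<close>
    have H: "(\<Sum>t\<in>?A. r t * q t u) \<ge> 0" if u: "u \<in> ?A" "u \<notin> (\<lambda>j. L k + j) ` {..<m k}" for u
    proof -
      obtain l j where l: "u = L l + j" "j < m l" "lev u = l" by (rule block_cases)
      have ls: "l \<le> s" using u(1) l lev_less_iff[of u "Suc s"] by simp
      consider "l < k" | "l = k" | "k < l" by linarith
      then show ?thesis
      proof cases
        case 1
        then have "r u = 0" using l by (simp add: r_def glue_block row_family_def)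
        have "0 \<le> r t * q t u" if "t \<in> ?A" for t
          using r_facts(1)[of t] off_diag[of t u] \<open>r u = 0\<close> that by (cases "t = u") auto
        then show ?thesis by (intro sum_nonneg)
      next
        case 2
        then show ?thesis using u l by auto
      next
        case 3
        then show ?thesis using r_facts(2)[of l j] l ls by simp
      qed
    qed
    have "(\<Sum>u\<in>(\<lambda>j. L k + j) ` {..<m k}. (\<Sum>t\<in>?A. r t * q t u) * w u)
        \<le> (\<Sum>u\<in>?A. (\<Sum>t\<in>?A. r t * q t u) * w u)"
      using H w(1) in_trunc by (intro sum_mono2) (auto intro!: mult_nonneg_nonneg simp: less_imp_le)
    also have "\<dots> = (\<Sum>t\<in>?A. r t * (\<Sum>u\<in>?A. q t u * w u))"
      unfolding sum_distrib_left sum_distrib_right by (subst sum.swap) (simp add: mult_ac)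
    also have "\<dots> < (\<Sum>t\<in>?A. 0)"
    proof (rule sum_strict_mono_ex1)
      show "\<forall>t\<in>?A. r t * (\<Sum>u\<in>?A. q t u * w u) \<le> 0"
        using r_facts(1) w(2) by (auto intro!: mult_nonneg_nonpos simp: less_imp_le)
      show "\<exists>t\<in>?A. r t * (\<Sum>u\<in>?A. q t u * w u) < 0"
        using w(2) in_trunc[OF i] rk[OF i] by (intro bexI[of _ "L k + i"]) auto
    qed simp
    also have "(\<Sum>u\<in>(\<lambda>j. L k + j) ` {..<m k}. (\<Sum>t\<in>?A. r t * q t u) * w u) =
        (\<Sum>j<m k. (\<Sum>t\<in>?A. r t * q t (L k + j)) * w (L k + j))"
      by (subst sum.reindex) (auto simp: inj_on_def)
    also have "\<dots> = - (\<Sum>j<m k. U s k $$ (i, j) * w (L k + j))"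
      by (simp add: r_facts(3) XU sum_negf)
    finally show "0 < (\<Sum>j<m k. U s k $$ (i, j) * w (L k + j))" by simp
    show "0 < w (L k + i)" using w(1) in_trunc[OF i] .
    fix j assume j: "j < m k" "i \<noteq> j"
    \<comment> \<open>Off the diagonal \<open>Q k k\<close> and the sum in the Schur complement are
      nonnegative, and \<open>U s k\<close> is minus their sum.\<close>
    have "0 \<le> (Rb s k l * Q l k) $$ (i, j)" if l: "l \<in> {k+1..s}" for l
    proof -
      have R: "Rb s k l \<in> carrier_mat (m k) (m l)" "nonneg_mat (Rb s k l)"
        using Rb_carrier_nonneg[of k l s] reg l by auto
      have "nonneg_mat (Rb s k l * Q l k)"
        using l by (intro nonneg_mat_mult[OF R(2) Q_off_nonneg R(1) Q_carrier]) auto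
      then show ?thesis
        by (rule nonneg_matD[OF _ mult_carrier_mat[OF R(1) Q_carrier] i j(1)])
    qed
    then have "0 \<le> (\<Sum>l\<in>{k+1..s}. (Rb s k l * Q l k) $$ (i, j))" by (intro sum_nonneg)
    moreover have "U s k $$ (i, j) =
        - Q k k $$ (i, j) - (\<Sum>l\<in>{k+1..s}. (Rb s k l * Q l k) $$ (i, j))"
      unfolding U_def using i j
      by (simp add: mat_sum_def carrier_matD[OF Q_carrier] del: index_mult_mat)
    ultimately show "U s k $$ (i, j) \<le> 0"
      using off_diag[of "L k + i" "L k + j"] i j by (simp add: Q_index)
  qed simp
  moreover have "Rs s k = mat_inv (U s k)" unfolding U_def by (rule Rstar_rec)
  ultimately show ?case by (simp add: regular_def)
qed

end

section \<open>Identification of the block formulas with occupation shares\<close>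

theorem theorem3p2:
  fixes q :: "nat \<Rightarrow> nat \<Rightarrow> real"
    and m :: "nat \<Rightarrow> nat"
    and \<pi> :: "nat \<Rightarrow> real"
    and \<alpha>0 :: "real mat"
    and b :: real
    and v :: "nat \<Rightarrow> real"
    and C :: "nat set"
  assumes m_pos: "\<And>k. m k > 0"
    and ergodic: "ergodic_generator q"
    and stationary: "stationary_distribution q \<pi>"
    and hessenberg: "lower_block_Hessenberg m q"
    and \<alpha>0_dim: "\<alpha>0 \<in> carrier_mat 1 (m 0)"
    and \<alpha>0_nonneg: "\<And>i. i < m 0 \<Longrightarrow> \<alpha>0 $$ (0, i) \<ge> 0"
    and \<alpha>0_sum: "(\<Sum>i<m 0. \<alpha>0 $$ (0, i)) = 1"
    and b_pos: "b > 0"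
    and v_ge_1: "\<And>i. v i \<ge> 1"
    and C_finite: "finite C"
    and drift: "\<And>i. (\<Sum>\<^sub>\<infinity>j. q i j * v j) \<le> - \<bar>q i i\<bar> - 1 + b * indicator C i"
  shows "(\<forall>k. \<forall>i < m k.
      (\<lambda>s. (\<alpha>0 * Rstar m q s 0 * Rblock m q s 0 k) $$ (0, i) /
            (\<alpha>0 * mat_sum (m 0) 1
               (\<lambda>l. Rstar m q s 0 * Rblock m q s 0 l * ones_col (m l)) {0..s}) $$ (0, 0))
        \<longlonglongrightarrow> row_block m \<pi> k $$ (0, i))
    \<and> (\<forall>k. \<forall>i < m k.
      (\<lambda>s. (\<alpha>0 * Rstar m q s 0 * mat_prod (m 0) (map (Rstep m q s) [1..<k+1])) $$ (0, i) /
            (\<alpha>0 * mat_sum (m 0) 1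
               (\<lambda>l. Rstar m q s 0 * mat_prod (m 0) (map (Rstep m q s) [1..<l+1])
                     * ones_col (m l)) {0..s}) $$ (0, 0))
        \<longlonglongrightarrow> row_block m \<pi> k $$ (0, i))"
proof -
  have stable: "stable_conservative q" and irreducible: "irreducible_generator q"
    using ergodic by (auto simp: ergodic_generator_def)
  interpret block_generator m q
    by unfold_locales (fact m_pos stable irreducible hessenberg)+
  define X where "X s = \<alpha>0 * Rs s 0" for s
  define F where "F s = row_family s 0 (X s)" for s
  define a where "a i = (if i < m 0 then \<alpha>0 $$ (0, i) else 0)" for i
  have reg: "regular s 0" "\<And>j. 0 < j \<Longrightarrow> j \<le> s \<Longrightarrow> regular s j" for s by (simp_all add: regular)
  then have R0: "Rs s 0 \<in> carrier_mat (m 0) (m 0)" "Rs s 0 * U s 0 = 1\<^sub>m (m 0)"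
    "nonneg_mat (Rs s 0)" for s by (auto simp: regular_def)
  have X: "X s \<in> carrier_mat 1 (m 0)" for s
    unfolding X_def by (rule mult_carrier_mat[OF \<alpha>0_dim R0(1)])
  have "nonneg_mat \<alpha>0" using \<alpha>0_dim \<alpha>0_nonneg by (auto simp: nonneg_mat_def)
  then have X_nonneg: "nonneg_mat (X s)" for s
    unfolding X_def by (rule nonneg_mat_mult[OF _ R0(3) \<alpha>0_dim R0(1)])
  \<comment> \<open>Since \<open>Rs s 0\<close> inverts \<open>U s 0\<close>, the balance at level 0
    has right side \<open>- \<alpha>0\<close>.\<close>
  have XU: "X s * U s 0 = \<alpha>0" for s
    using assoc_mult_mat[OF \<alpha>0_dim R0(1) U_carrier] R0(2) right_mult_one_mat[OF \<alpha>0_dim]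
    by (simp add: X_def)
  have Rb: "Rb s 0 l \<in> carrier_mat (m 0) (m l)" if "l \<le> s" for s l
    using Rb_carrier_nonneg[of 0 l s] regular that by auto
  have F_carrier: "F s l \<in> carrier_mat 1 (m l)" if "l \<le> s" for s l
    unfolding F_def by (rule row_family_carrier[OF _ reg(2) X that]) auto
  have F_eq: "F s l = X s * Rb s 0 l" for s l by (simp add: F_def row_family_def)
  have L1: "L (Suc 0) = m 0" by (simp add: L_Suc L_0)
  interpret truncated_occupation q "\<lambda>s. L (Suc s)" a "\<lambda>s. glue (F s)" b v C \<pi>
  proof
    show "0 \<le> glue (F s) t" if "t < L (Suc s)" for s t
      unfolding F_def by (rule glue_nonneg[OF _ reg(2) X X_nonneg that]) auto
    show "(\<Sum>t<L (Suc s). glue (F s) t * q t u) = - a u" if u: "u < L (Suc s)" for s u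
    proof -
      obtain l j where l: "u = L l + j" "j < m l" "lev u = l" by (rule block_cases)
      have ls: "l \<le> s" using u l lev_less_iff[of u "Suc s"] by simp
      show ?thesis
      proof (cases "l = 0")
        case True
        then show ?thesis
          using glue_balance_start[OF _ reg(2) X, of s j] l XU by (simp add: F_def a_def L_0)
      next
        case False
        then have "\<not> u < m 0" using l lev_less_iff[of u 1] by (simp add: L1)
        then show ?thesis
          using glue_balance[OF _ reg(2) X, of s l j] False l ls by (simp add: F_def a_def)
      qed
    qed
    show "act v i \<le> - \<bar>q i i\<bar> - 1 + b * indicator C i" for i
      unfolding act_def by (rule drift)
  qed (use \<alpha>0_nonneg \<alpha>0_sum b_pos v_ge_1 C_finite stationary in \<open>auto simp: a_def L1\<close>)
  have num: "(\<alpha>0 * Rs s 0 * Rb s 0 k) $$ (0, i) = glue (F s) (L k + i)" if "i < m k" for s k i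
    using that by (simp add: glue_block F_eq X_def)
  \<comment> \<open>The columns of ones add up the entries of all blocks, so the denominator is the
    total mass of the occupation row.\<close>
  have den: "(\<alpha>0 * mat_sum (m 0) 1 (\<lambda>l. Rs s 0 * Rb s 0 l * ones_col (m l)) {0..s}) $$ (0, 0)
      = mass s" for s
  proof -
    have o: "ones_col n \<in> carrier_mat n 1" for n by (simp add: ones_col_def)
    have RR: "Rs s 0 * Rb s 0 l \<in> carrier_mat (m 0) (m l)" if "l \<le> s" for l
      by (rule mult_carrier_mat[OF R0(1) Rb[OF that]])
    have "(\<alpha>0 * mat_sum (m 0) 1 (\<lambda>l. Rs s 0 * Rb s 0 l * ones_col (m l)) {0..s}) $$ (0, 0)
        = (\<Sum>l\<in>{0..s}. (\<alpha>0 * (Rs s 0 * Rb s 0 l * ones_col (m l))) $$ (0, 0))"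
      using mult_carrier_mat[OF RR o]
      by (subst mult_mat_sum[OF \<alpha>0_dim]) (auto simp del: index_mult_mat)
    also have "\<dots> = (\<Sum>l\<in>{0..s}. \<Sum>j<m l. F s l $$ (0, j))"
    proof (rule sum.cong)
      fix l assume "l \<in> {0..s}"
      then have l: "l \<le> s" by simp
      have "\<alpha>0 * (Rs s 0 * Rb s 0 l * ones_col (m l)) = F s l * ones_col (m l)"
        using assoc_mult_mat[OF \<alpha>0_dim RR[OF l] o] assoc_mult_mat[OF \<alpha>0_dim R0(1) Rb[OF l]]
        by (simp add: F_eq X_def)
      moreover have "(F s l * ones_col (m l)) $$ (0, 0) = (\<Sum>j<m l. F s l $$ (0, j) * ones_col (m l) $$ (j, 0))"
        by (rule mult_mat_index[OF F_carrier[OF l] o]) auto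
      ultimately show "(\<alpha>0 * (Rs s 0 * Rb s 0 l * ones_col (m l))) $$ (0, 0) = (\<Sum>j<m l. F s l $$ (0, j))"
        by (simp add: ones_col_def del: index_mult_mat)
    qed simp
    also have "\<dots> = mass s"
      unfolding mass_def sum_blocks
      by (simp add: glue_block atLeast0AtMost lessThan_Suc_atMost)
    finally show ?thesis .
  qed
  \<comment> \<open>The two forms of the limit coincide, as \<open>Rstep m q s j\<close> is the
    factor of \<open>Rblock\<close> with index \<open>j\<close>.\<close>
  have Rb_steps: "mat_prod (m 0) (map (Rstep m q s) [1..<k+1]) = Rb s 0 k" for s k
    by (simp add: Rblock_def Rstep_def[abs_def])
  have "(\<lambda>s. (\<alpha>0 * Rs s 0 * Rb s 0 k) $$ (0, i) /
      (\<alpha>0 * mat_sum (m 0) 1 (\<lambda>l. Rs s 0 * Rb s 0 l * ones_col (m l)) {0..s}) $$ (0, 0))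
      \<longlonglongrightarrow> row_block m \<pi> k $$ (0, i)" if "i < m k" for k i
    unfolding den using share_tendsto[of "L k + i"] that by (simp add: num row_block_def del: index_mult_mat)
  then show ?thesis unfolding Rb_steps by blast
qed

end
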